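(* Let $G$ be a connected graph with at least two vertices, and let $\tau(G)$ be its triangulation. Then $\gamma_t(\tau(G))\leq a(\tau(G))+1$.
   Context: All graphs are finite and simple. $m(G)$ denotes the number of edges of $G$. A total dominating set of $G$ is a set $D\subseteq V(G)$ such that every vertex of $V(G)$ has a neighbor in $D$; the total domination number $\gamma_t(G)$ is the minimum cardinality of a total dominating set of $G$. If $d_1\leq d_2\leq\cdots\leq d_n$ is the ordered degree sequence of $G$, the annihilation number $a(G)$ is the largest integer $k$ with $k\le n$ such that $\sum_{i=1}^{k} d_i\leq m(G)$. The triangulation $\tau(G)$ of a graph $G$ is the graph obtained from $G$ by adding, for each edge $e=uv$ of $G$, a new vertex $x_e$ and the two edges $x_eu$ and $x_ev$ (all edges of $G$ are kept). *)

theory Defs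
  imports "Graph_Theory.Digraph_Component" "HOL-Library.Multiset"
begin

text \<open>
  A finite simple graph is a \<^locale>\<open>pair_graph\<close>: a finite, loop-free, symmetric digraph whose
  arcs are pairs of vertices. An undirected edge $uv$ is thus represented by the two arcs
  \<^term>\<open>(u, v)\<close> and \<^term>\<open>(v, u)\<close>, and the degree of a vertex is its \<^const>\<open>out_degree\<close>.
\<close>

definition edges :: "'a pair_pre_digraph \<Rightarrow> 'a set set" where
  "edges G = (\<lambda>(u, v). {u, v}) ` parcs G"

definition total_dominating_set :: "'a pair_pre_digraph \<Rightarrow> 'a set \<Rightarrow> bool" where
  "total_dominating_set G D \<longleftrightarrow>
     D \<subseteq> pverts G \<and> (\<forall>v \<in> pverts G. \<exists>u \<in> D. (v, u) \<in> parcs G)"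

text \<open>Only meaningful for graphs without isolated vertices; others have no total dominating set.\<close>
definition total_domination_number :: "'a pair_pre_digraph \<Rightarrow> nat" where
  "total_domination_number G = (LEAST k. \<exists>D. total_dominating_set G D \<and> card D = k)"

definition degree_sequence :: "'a pair_pre_digraph \<Rightarrow> nat list" where
  "degree_sequence G =
     sorted_list_of_multiset (image_mset (out_degree (with_proj G)) (mset_set (pverts G)))"

text \<open>The list is indexed from $0$, so $d_1 + \dots + d_k$ is the sum of its entries below $k$.\<close>
definition annihilation_number :: "'a pair_pre_digraph \<Rightarrow> nat" where
  "annihilation_number G =
     (GREATEST k. k \<le> card (pverts G) \<and> (\<Sum>i<k. degree_sequence G ! i) \<le> card (edges G))"

text \<open>
  Original vertices are tagged with \<^const>\<open>Inl\<close>; the new vertex $x_e$ of an edge $e$ is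
  \<^term>\<open>Inr e\<close>.
\<close>
definition triangulation :: "'a pair_pre_digraph \<Rightarrow> ('a + 'a set) pair_pre_digraph" where
  "triangulation G =
     \<lparr> pverts = Inl ` pverts G \<union> Inr ` edges G,
       parcs = {(Inl u, Inl v) | u v. (u, v) \<in> parcs G}
             \<union> {(Inl u, Inr e) | u e. e \<in> edges G \<and> u \<in> e}
             \<union> {(Inr e, Inl u) | u e. e \<in> edges G \<and> u \<in> e} \<rparr>"

lemma out_degree_eq_card_edges:
  assumes "pair_graph G"
  shows "out_degree (with_proj G) v = card {e \<in> edges G. v \<in> e}"
proof -
  interpret pair_graph G by fact
  have sym: "(a, b) \<in> parcs G \<Longrightarrow> (b, a) \<in> parcs G" for a b
    using pair_sym_arcs by (auto simp: symmetric_def sym_def)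
  have "bij_betw (\<lambda>(u, v). {u, v}) (out_arcs (with_proj G) v) {e \<in> edges G. v \<in> e}"
    unfolding bij_betw_def
  proof
    show "inj_on (\<lambda>(u, v). {u, v}) (out_arcs (with_proj G) v)"
      by (auto simp: inj_on_def out_arcs_def doubleton_eq_iff)
    show "(\<lambda>(u, v). {u, v}) ` out_arcs (with_proj G) v = {e \<in> edges G. v \<in> e}"
      using sym by (fastforce simp: out_arcs_def edges_def image_iff insert_commute)
  qed
  then show ?thesis
    unfolding out_degree_def by (rule bij_betw_same_card)
qed

lemma pair_graph_triangulation:
  assumes "pair_graph G"
  shows "pair_graph (triangulation G)"
proof -
  interpret pair_graph G by fact
  have sub: "e \<subseteq> pverts G" if "e \<in> edges G" for e
    using that by (auto simp: edges_def dest: wellformed')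
  have fin: "finite (pverts (triangulation G))"
    by (simp add: triangulation_def edges_def pair_finite_verts pair_finite_arcs)
  have arcs: "parcs (triangulation G) \<subseteq> pverts (triangulation G) \<times> pverts (triangulation G)"
    using sub by (auto simp: triangulation_def dest: wellformed')
  have sym: "sym (parcs (triangulation G))"
    using pair_sym_arcs by (auto simp: triangulation_def symmetric_def sym_def)
  have loopfree: "fst e \<noteq> snd e" if "e \<in> parcs (triangulation G)" for e
    using that by (auto simp: triangulation_def dest: pair_no_loops)
  show ?thesis
    using fin arcs sym loopfree finite_subset[OF arcs]
    by unfold_locales (auto simp: symmetric_def)
qed

end

theory Submission
  imports Defs
begin

text \<open>
  Let $n$ and $m$ be the numbers of vertices and edges of $G$. The bound splits as
  $\gamma_t(\tau(G)) \<le> n \<le> m + 1 \<le> a(\tau(G)) + 1$.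

  The first inequality holds because the original vertices dominate $\tau(G)$ totally: each $x_e$ sees
  the ends of $e$, and each vertex of $G$ has a neighbour in $G$, as $G$ is connected and not a
  single vertex. The second is the usual lower bound on the size of a connected graph. The third
  is the inequality \<open>independence number \<le> annihilation number\<close>, valid in every graph, applied to the
  $m$ new vertices: they are pairwise non-adjacent. It holds because no edge meets an independent
  set twice, so the degrees over the set add up to at most the number of edges, and the equally
  many smallest degrees add up to no more than that.
\<close>

lemma sum_list_take_sorted_le_sum_mset:
  fixes xs :: "nat list"
  assumes "sorted xs" "M \<subseteq># mset xs"
  shows "sum_list (take (size M) xs) \<le> \<Sum>\<^sub># M"
  using assms
proof (induction xs arbitrary: M)
  case Nil
  then show ?case by simp
next
  case (Cons x xs)
  show ?case
  proof (cases "M = {#}")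
    case False
    \<comment> \<open>Remove from \<open>M\<close> an entry that the head can be charged to: the head itself if it occurs
      in \<open>M\<close>, so that the rest of \<open>M\<close> lies in the tail.\<close>
    have "\<exists>y\<in>#M. x \<le> y \<and> M - {#y#} \<subseteq># mset xs"
    proof (cases "x \<in># M")
      case True
      then show ?thesis
        using Cons.prems(2) by (intro bexI[of _ x]) (auto simp: subset_eq_diff_conv)
    next
      case x_notin: False
      have "M - {#x#} \<subseteq># mset xs"
        using Cons.prems(2) by (simp add: subset_eq_diff_conv)
      then have sub: "M \<subseteq># mset xs" using x_notin by simp
      obtain y where "y \<in># M" using False by blast
      moreover have "x \<le> y"
        using calculation sub Cons.prems(1) by (auto dest: mset_subset_eqD)
      moreover have "M - {#y#} \<subseteq># mset xs"
        using sub by (meson diff_subset_eq_self subset_mset.order_trans)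
      ultimately show ?thesis by blast
    qed
    then obtain y where y: "y \<in># M" "x \<le> y" "M - {#y#} \<subseteq># mset xs" by blast
    then obtain N where M: "M = add_mset y N" by (metis insert_DiffM)
    have "sum_list (take (size N) xs) \<le> \<Sum>\<^sub># N"
      using Cons.IH[of N] Cons.prems(1) y(3) by (simp add: M)
    then show ?thesis using y(2) by (simp add: M)
  qed simp
qed

lemma card_le_annihilation_number:
  assumes fin: "finite (pverts H)" and U: "U \<subseteq> pverts H"
    and sum: "(\<Sum>v\<in>U. out_degree (with_proj H) v) \<le> card (edges H)"
  shows "card U \<le> annihilation_number H"
proof -
  let ?deg = "out_degree (with_proj H)"
  let ?M = "image_mset ?deg (mset_set U)"
  have finU: "finite U" using U fin by (rule finite_subset)
  have size: "card U \<le> card (pverts H)" using fin U by (rule card_mono)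
  have len: "length (degree_sequence H) = card (pverts H)"
    unfolding degree_sequence_def
    by (metis mset_sorted_list_of_multiset size_image_mset size_mset size_mset_set)
  have "sorted (degree_sequence H)" by (simp add: degree_sequence_def)
  moreover have "?M \<subseteq># mset (degree_sequence H)"
    using U fin by (simp add: degree_sequence_def image_mset_subseteq_mono subset_imp_msubset_mset_set)
  ultimately have "sum_list (take (card U) (degree_sequence H)) \<le> \<Sum>\<^sub># ?M"
    using sum_list_take_sorted_le_sum_mset[of "degree_sequence H" ?M] by simp
  also have "\<dots> = (\<Sum>v\<in>U. ?deg v)" by (simp add: sum_unfold_sum_mset)
  also have "sum_list (take (card U) (degree_sequence H)) = (\<Sum>i<card U. degree_sequence H ! i)"
    using size len by (simp add: sum_list_sum_nth atLeast0LessThan)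
  finally have "(\<Sum>i<card U. degree_sequence H ! i) \<le> card (edges H)" using sum by simp
  then show ?thesis
    unfolding annihilation_number_def using size
    by (intro Greatest_le_nat[where b = "card (pverts H)"]) auto
qed

text \<open>
  The edge sets at two vertices of an independent set are disjoint, so the degrees over such a set
  count distinct edges.
\<close>
lemma card_independent_le_annihilation_number:
  assumes H: "pair_graph H" and U: "U \<subseteq> pverts H"
    and indep: "\<And>u v. u \<in> U \<Longrightarrow> v \<in> U \<Longrightarrow> (u, v) \<notin> parcs H"
  shows "card U \<le> annihilation_number H"
proof (rule card_le_annihilation_number)
  interpret pair_graph H by fact
  show "finite (pverts H)" by (rule pair_finite_verts)
  then have finU: "finite U" using U by (rule rev_finite_subset)
  have finE: "finite (edges H)" by (simp add: edges_def pair_finite_arcs)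
  have disj: "{e \<in> edges H. u \<in> e} \<inter> {e \<in> edges H. v \<in> e} = {}"
    if "u \<in> U" "v \<in> U" "u \<noteq> v" for u v
    using that indep by (fastforce simp: edges_def)
  have "(\<Sum>v\<in>U. out_degree (with_proj H) v) = (\<Sum>v\<in>U. card {e \<in> edges H. v \<in> e})"
    by (simp add: out_degree_eq_card_edges[OF H])
  also have "\<dots> = card (\<Union>v\<in>U. {e \<in> edges H. v \<in> e})"
    using finU finE disj by (subst card_UN_disjoint) auto
  also have "\<dots> \<le> card (edges H)" using finE by (intro card_mono) auto
  finally show "(\<Sum>v\<in>U. out_degree (with_proj H) v) \<le> card (edges H)" .
qed (fact U)

text \<open>
  This is the form in which connectedness is used, both for the edge count and, with a singleton
  \<open>S\<close>, for the existence of a neighbour.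
\<close>
lemma connected_crossing_arc:
  assumes G: "pair_graph G" and con: "connected (with_proj G)"
    and S: "S \<subset> pverts G" "S \<noteq> {}"
  obtains u v where "u \<in> S" "v \<in> pverts G - S" "(u, v) \<in> parcs G"
proof (rule ccontr)
  interpret pair_graph G by fact
  assume no: "\<not> thesis"
  obtain r w where r: "r \<in> S" and w: "w \<in> pverts G" "w \<notin> S" using S by blast
  have "r \<rightarrow>\<^sup>*\<^bsub>with_proj (mk_symmetric (with_proj G))\<^esub> w"
    using con r w S(1) by (auto simp: connected_def strongly_connected_def)
  then have "r \<rightarrow>\<^sup>*\<^bsub>with_proj G\<^esub> w" by (simp add: reachable_mk_symmetric_eq sym_arcs)
  then have "(r, w) \<in> (parcs G)\<^sup>*" using reachable_rtranclI by fastforce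
  then have "w \<in> S"
  proof (induction rule: rtrancl_induct)
    case (step y z)
    then have "z \<in> pverts G" by (auto dest: wellformed')
    with step that no show ?case by blast
  qed (fact r)
  with w show False by simp
qed

text \<open>
  A maximal vertex set $S$ inducing at least $|S| - 1$ edges is the whole vertex set: otherwise
  some edge leaves $S$, and adding its outer end brings one more vertex and at least one more edge.
\<close>
lemma card_verts_le_Suc_card_edges:
  assumes G: "pair_graph G" and con: "connected (with_proj G)"
  shows "card (pverts G) \<le> card (edges G) + 1"
proof -
  interpret pair_graph G by fact
  have finV: "finite (pverts G)" by (rule pair_finite_verts)
  have finE: "finite (edges G)" by (simp add: edges_def pair_finite_arcs)
  obtain r where r: "r \<in> pverts G"
    using con by (auto simp: connected_def strongly_connected_def)
  define \<F> where
    "\<F> = {S. S \<subseteq> pverts G \<and> S \<noteq> {} \<and> card S \<le> card {e \<in> edges G. e \<subseteq> S} + 1}"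
  have "finite \<F>" using finV by (auto simp: \<F>_def)
  moreover have "{r} \<in> \<F>" using r by (simp add: \<F>_def)
  ultimately obtain S where S: "S \<in> \<F>" and max: "\<And>T. T \<in> \<F> \<Longrightarrow> S \<subseteq> T \<Longrightarrow> T = S"
    using finite_has_maximal[of \<F>] by (metis empty_iff)
  have "S = pverts G"
  proof (rule ccontr)
    assume "S \<noteq> pverts G"
    then obtain u v where uv: "u \<in> S" "v \<in> pverts G - S" "(u, v) \<in> parcs G"
      using connected_crossing_arc[OF G con, of S] S by (auto simp: \<F>_def)
    have finS: "finite S" using S finV by (auto simp: \<F>_def intro: finite_subset)
    have "{u, v} \<in> edges G" using uv(3) by (force simp: edges_def)
    then have "insert {u, v} {e \<in> edges G. e \<subseteq> S} \<subseteq> {e \<in> edges G. e \<subseteq> insert v S}"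
      using uv(1) by auto
    then have "card (insert {u, v} {e \<in> edges G. e \<subseteq> S}) \<le> card {e \<in> edges G. e \<subseteq> insert v S}"
      using finE by (intro card_mono) auto
    then have "card {e \<in> edges G. e \<subseteq> S} + 1 \<le> card {e \<in> edges G. e \<subseteq> insert v S}"
      using finE uv(2) by simp
    then have "insert v S \<in> \<F>" using S uv(2) finS by (auto simp: \<F>_def)
    from max[OF this] uv(2) show False by blast
  qed
  moreover have "card {e \<in> edges G. e \<subseteq> S} \<le> card (edges G)"
    using finE by (intro card_mono) auto
  ultimately show ?thesis using S by (auto simp: \<F>_def)
qed

lemma total_dominating_set_triangulation:
  assumes G: "pair_graph G" and con: "connected (with_proj G)" and two: "card (pverts G) \<ge> 2"
  shows "total_dominating_set (triangulation G) (Inl ` pverts G)"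
proof -
  interpret pair_graph G by fact
  have nbr: "\<exists>u\<in>pverts G. (v, u) \<in> parcs G" if v: "v \<in> pverts G" for v
  proof -
    have "{v} \<noteq> pverts G"
    proof
      assume "{v} = pverts G"
      then have "card (pverts G) = card {v}" by simp
      then show False using two by simp
    qed
    then have "{v} \<subset> pverts G" using v by blast
    then show ?thesis using connected_crossing_arc[OF G con, of "{v}"] by blast
  qed
  have "\<exists>u\<in>pverts G. u \<in> e" if "e \<in> edges G" for e
    using that by (force simp: edges_def dest: wellformed')
  with nbr show ?thesis
    unfolding total_dominating_set_def triangulation_def by fastforce
qed

lemma card_edges_le_annihilation_number_triangulation:
  assumes "pair_graph G"
  shows "card (edges G) \<le> annihilation_number (triangulation G)"
proof -
  have "card (Inr ` edges G :: ('a + 'a set) set) \<le> annihilation_number (triangulation G)"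
    using pair_graph_triangulation[OF assms]
    by (rule card_independent_le_annihilation_number) (auto simp: triangulation_def)
  then show ?thesis by (simp add: card_image)
qed

theorem proposition3p1:
  fixes G :: "'a pair_pre_digraph"
  assumes "pair_graph G"
    and "connected (with_proj G)"
    and "card (pverts G) \<ge> 2"
  shows "total_domination_number (triangulation G) \<le> annihilation_number (triangulation G) + 1"
proof -
  have "total_domination_number (triangulation G) \<le> card (Inl ` pverts G :: ('a + 'a set) set)"
    unfolding total_domination_number_def
    using total_dominating_set_triangulation[OF assms] by (intro Least_le) blast
  also have "\<dots> = card (pverts G)" by (simp add: card_image)
  also have "\<dots> \<le> card (edges G) + 1"
    using assms(1,2) by (rule card_verts_le_Suc_card_edges)
  also have "\<dots> \<le> annihilation_number (triangulation G) + 1"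
    using card_edges_le_annihilation_number_triangulation[OF assms(1)] by simp
  finally show ?thesis .
qed

end
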